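(* Let $n \geq 3$ be a natural number. Let $P$ be a convex polygon in the Euclidean plane with the consecutive vertices $A_1,A_2,A_3,\dots,A_{n-1},A_n$ such that the sides $A_1A_2$ and $A_2A_3$ have struts and $|A_1A_2|+|A_2A_3|\geq 1$. Then the perimeter $L(P)$ of $P$ satisfies the inequality $L(P)\geq 3$.
   Context: The Euclidean plane is $\mathbb{R}^2$ with the standard Euclidean metric $d$, and $|XY|=d(X,Y)$. A convex polygon is the convex hull of a finite set of points in $\mathbb{R}^2$. A side $AB$ of a convex polygon $P$ is said to have a strut if there exists a point $C\in P$ (not necessarily a vertex of $P$) such that $d(A,C)=d(B,C)=1$. *)

theory Defs
  imports "HOL-Analysis.Analysis"
begin

definition is_side :: "(real^2) set \<Rightarrow> real^2 \<Rightarrow> real^2 \<Rightarrow> bool" where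
  "is_side P X Y \<longleftrightarrow> closed_segment X Y edge_of P"

text \<open>
  The vertices are the values \<open>A 1, \<dots>, A n\<close>; other values of \<open>A\<close> are irrelevant. Vertices are
  genuine corners (extreme points), listed without repetition in cyclic order along the boundary.
  For \<open>n \<ge> 3\<close> this forces \<open>P\<close> to be two-dimensional, since a segment has only two extreme points.
\<close>
definition convex_polygon :: "(real^2) set \<Rightarrow> nat \<Rightarrow> (nat \<Rightarrow> real^2) \<Rightarrow> bool" where
  "convex_polygon P n A \<longleftrightarrow>
     P = convex hull (A ` {1..n}) \<and>
     inj_on A {1..n} \<and>
     {X. X extreme_point_of P} = A ` {1..n} \<and>
     (\<forall>i\<in>{1..<n}. is_side P (A i) (A (i + 1))) \<and>
     is_side P (A n) (A 1)"

definition has_strut :: "(real^2) set \<Rightarrow> real^2 \<Rightarrow> real^2 \<Rightarrow> bool" where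
  "has_strut P X Y \<longleftrightarrow> (\<exists>C\<in>P. dist X C = 1 \<and> dist Y C = 1)"

definition perimeter :: "nat \<Rightarrow> (nat \<Rightarrow> real^2) \<Rightarrow> real" where
  "perimeter n A = (\<Sum>i\<in>{1..<n}. dist (A i) (A (i + 1))) + dist (A n) (A 1)"

end

theory Submission
  imports Defs
begin

text \<open>
  Write \<open>B = A 2\<close>, \<open>V = A 1\<close>, \<open>W = A 3\<close> and let \<open>D\<close>, \<open>E\<close> be the strut points of the sides
  \<open>VB\<close> and \<open>BW\<close>, so that \<open>|BD| = |VD| = |BE| = |WE| = 1\<close>. The perimeter of \<open>P\<close> is at least that
  of any convex polygon with corners in \<open>P\<close>, so it suffices to find one of perimeter at least \<open>3\<close>.

  If \<open>|VB|\<close>, \<open>|BW|\<close> or \<open>|DE|\<close> is at least \<open>1\<close>, one of the triangles \<open>VBD\<close>, \<open>WBE\<close>, \<open>BDE\<close> does. Otherwise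
  consider the pentagon formed by \<open>B\<close>, \<open>V\<close>, \<open>D\<close>, \<open>E\<close>, \<open>W\<close>. Since \<open>VB\<close> and \<open>BW\<close> are sides of \<open>P\<close>, the
  points \<open>D\<close> and \<open>E\<close> lie in the angle \<open>VBW\<close> (\<open>edge_supporting_line\<close>,
  \<open>cone_of_two_supporting_lines\<close>). They lie on the unit circle around \<open>B\<close>, while \<open>V\<close> and \<open>W\<close>
  lie in the unit disc, so the pentagon with its corners in angular order around \<open>B\<close> is convex.
  \<^item> If the order is \<open>V, D, E, W\<close>, its perimeter is \<open>|VB| + 1 + |DE| + 1 + |BW| \<ge> 3\<close>.
  \<^item> If the order is \<open>V, E, D, W\<close>, Ptolemy's inequality for \<open>V, B, D, E\<close> gives
    \<open>1 \<le> |VE| + |VB| |DE|\<close>, and likewise \<open>1 \<le> |WD| + |WB| |DE|\<close>. With \<open>\<sigma> = |VB| + |BW| \<ge> 1\<close> and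
    \<open>|DE| \<le> 1\<close> the perimeter is at least \<open>\<sigma> + 2 + |DE| (1 - \<sigma>) = 3 + (\<sigma> - 1) (1 - |DE|) \<ge> 3\<close>
    (\<open>crossed_struts\<close>).

  Monotonicity of the perimeter comes from Cauchy's formula. The length of a vector is, up to a
  constant, the mean length of its projections onto all lines through the origin. A closed walk
  through the vertices of \<open>P\<close> projects to a closed walk on the line that covers the width of \<open>P\<close>
  at least twice, whereas a convex polygon covers its own width exactly twice
  (\<open>perimeter_ge_if_projections_le_width\<close>).
\<close>

section \<open>Perimeter as an average of widths\<close>

definition direction :: "real \<Rightarrow> real^2" where
  "direction t = vector [cos t, sin t]"

lemma inner_direction: "v \<bullet> direction t = v $ 1 * cos t + v $ 2 * sin t"
  by (simp add: direction_def inner_vec_def sum_2)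

lemma integral_abs_cos_shift:
  assumes "0 \<le> c" "c \<le> 2 * pi"
  shows "integral {0..2*pi} (\<lambda>t. \<bar>cos (t - c)\<bar>) = integral {0..2*pi} (\<lambda>t. \<bar>cos t\<bar>)"
proof -
  let ?f = "\<lambda>t::real. \<bar>cos t\<bar>"
  have int: "?f integrable_on {a..b}" for a b :: real
    by (intro integrable_continuous_interval continuous_intros)
  have "integral {0..2*pi} (\<lambda>t. ?f (t - c)) = integral {-c..2*pi-c} ?f"
    using integral_shift_real_ivl[of "-c" "-c" "2*pi-c" ?f] by simp
  also have "\<dots> = integral {-c..0} ?f + integral {0..2*pi-c} ?f"
    using assms int by (intro Henstock_Kurzweil_Integration.integral_combine[symmetric]) auto
  also have "integral {-c..0} ?f = integral {2*pi-c..2*pi} ?f"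
    using integral_shift_real_ivl[of "2*pi-c" "2*pi" "2*pi" ?f] by simp
  also have "integral {2*pi-c..2*pi} ?f + integral {0..2*pi-c} ?f = integral {0..2*pi} ?f"
    using assms int Henstock_Kurzweil_Integration.integral_combine[of 0 "2*pi-c" "2*pi" ?f] by simp
  finally show ?thesis .
qed

lemma integral_abs_cos_pos: "0 < integral {0..2*pi} (\<lambda>t. \<bar>cos t :: real\<bar>)"
proof -
  have "((\<lambda>t. cos t) has_integral (sin (pi/2) - sin 0)) {0..pi/2}"
    by (intro fundamental_theorem_of_calculus)
      (auto intro!: derivative_eq_intros simp flip: has_real_derivative_iff_has_vector_derivative)
  then have "1 = integral {0..pi/2} cos"
    by (simp add: integral_unique)
  also have "\<dots> = integral {0..pi/2} (\<lambda>t. \<bar>cos t\<bar>)"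
    by (intro integral_cong) (simp add: cos_ge_zero)
  also have "\<dots> \<le> integral {0..2*pi} (\<lambda>t. \<bar>cos t\<bar>)"
    by (intro integral_subset_le integrable_continuous_interval continuous_intros) auto
  finally show ?thesis by simp
qed

text \<open>
  In polar coordinates \<open>v = r (cos c, sin c)\<close> the projection onto direction \<open>t\<close> is \<open>r cos (t - c)\<close>,
  and the integral of \<open>|cos|\<close> over a full period does not see the phase \<open>c\<close>.
\<close>
lemma integral_abs_projection:
  "integral {0..2*pi} (\<lambda>t. \<bar>v \<bullet> direction t\<bar>) = norm v * integral {0..2*pi} (\<lambda>t. \<bar>cos t\<bar>)"
proof (cases "v = 0")
  case False
  define r where "r = norm v"
  have r: "r > 0" "r\<^sup>2 = (v $ 1)\<^sup>2 + (v $ 2)\<^sup>2"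
    using False by (auto simp: r_def power2_norm_eq_inner inner_vec_def sum_2)
      (simp add: power2_eq_square)
  then have "(v $ 1 / r)\<^sup>2 + (v $ 2 / r)\<^sup>2 = r\<^sup>2 / r\<^sup>2"
    by (simp only: power_divide add_divide_distrib)
  then have "(v $ 1 / r)\<^sup>2 + (v $ 2 / r)\<^sup>2 = 1"
    using r(1) by simp
  then obtain c where c: "0 \<le> c" "c < 2 * pi" "v $ 1 / r = cos c" "v $ 2 / r = sin c"
    by (rule sincos_total_2pi)
  then have "v $ 1 = r * cos c" "v $ 2 = r * sin c"
    using r by (auto simp: field_simps)
  then have "v \<bullet> direction t = r * cos (t - c)" for t
    by (simp add: inner_direction cos_diff algebra_simps)
  then show ?thesis
    using r c integral_abs_cos_shift[of c] by (simp add: abs_mult r_def)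
qed simp

text \<open>
  This is how lengths are compared in the plane: it reduces the comparison to one on the real
  line, for each direction separately. Integrating over all directions gives back the lengths.
\<close>
lemma sum_norm_le_if_projections_le:
  fixes vs ws :: "(real^2) list"
  assumes "\<And>u. (\<Sum>v\<leftarrow>vs. \<bar>v \<bullet> u\<bar>) \<le> (\<Sum>w\<leftarrow>ws. \<bar>w \<bullet> u\<bar>)"
  shows "(\<Sum>v\<leftarrow>vs. norm v) \<le> (\<Sum>w\<leftarrow>ws. norm w)"
proof -
  let ?K = "integral {0..2*pi} (\<lambda>t. \<bar>cos t :: real\<bar>)"
  have single: "((\<lambda>t. \<bar>v \<bullet> direction t\<bar>) has_integral norm v * ?K) {0..2*pi}" for v
    unfolding integral_abs_projection[symmetric] inner_direction
    by (intro integrable_integral integrable_continuous_interval continuous_intros)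
  have total: "((\<lambda>t. \<Sum>v\<leftarrow>vs. \<bar>v \<bullet> direction t\<bar>) has_integral (\<Sum>v\<leftarrow>vs. norm v) * ?K) {0..2*pi}" for vs
    by (induction vs) (auto simp: distrib_right intro!: has_integral_add single)
  have "(\<Sum>v\<leftarrow>vs. norm v) * ?K \<le> (\<Sum>w\<leftarrow>ws. norm w) * ?K"
    using assms by (intro has_integral_le[OF total total])
  then show ?thesis
    using integral_abs_cos_pos by simp
qed

lemma convex_hull_inner_le_vertex:
  assumes "finite S" "X \<in> convex hull S"
  shows "\<exists>V\<in>S. X \<bullet> u \<le> V \<bullet> u"
proof (rule ccontr)
  assume "\<not> ?thesis"
  then have "S \<subseteq> {V. u \<bullet> V < u \<bullet> X}"
    by (auto simp: inner_commute)
  then have "convex hull S \<subseteq> {V. u \<bullet> V < u \<bullet> X}"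
    by (intro hull_minimal convex_halfspace_lt)
  then show False using assms by auto
qed

lemma abs_diff_le_sum_steps:
  fixes f :: "nat \<Rightarrow> real"
  assumes "i \<le> j"
  shows "\<bar>f i - f j\<bar> \<le> (\<Sum>k\<in>{i..<j}. \<bar>f k - f (k + 1)\<bar>)"
  using assms by (induction j rule: dec_induct) auto

text \<open>
  The walk \<open>f 1, \<dots>, f n, f 1\<close> passes \<open>f i\<close> and \<open>f j\<close>, hence has to get from one to the other and back.
\<close>
lemma closed_walk_variation:
  fixes f :: "nat \<Rightarrow> real"
  assumes "i \<in> {1..n}" "j \<in> {1..n}"
  shows "2 * \<bar>f i - f j\<bar> \<le> (\<Sum>k\<in>{1..<n}. \<bar>f k - f (k + 1)\<bar>) + \<bar>f n - f 1\<bar>"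
  using assms
proof (induction i j rule: linorder_wlog)
  case (le i j)
  define s where "s a b = (\<Sum>k\<in>{a..<b}. \<bar>f k - f (k + 1)\<bar>)" for a b
  have "s 1 i + s i j + s j n = s 1 n"
    using le by (simp add: s_def sum.atLeastLessThan_concat)
  moreover have "\<bar>f 1 - f i\<bar> \<le> s 1 i" "\<bar>f i - f j\<bar> \<le> s i j" "\<bar>f j - f n\<bar> \<le> s j n"
    using le abs_diff_le_sum_steps by (auto simp: s_def)
  ultimately show ?case
    unfolding s_def[symmetric] by (smt (verit))
next
  case (sym i j)
  then show ?case by (simp only: abs_minus_commute)
qed

text \<open>
  In each direction the boundary walk covers the width of the polygon twice. So any list of vectors
  whose projections always total at most twice that width is no longer than the perimeter.
\<close>
lemma perimeter_ge_if_projections_le_width: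
  fixes A :: "nat \<Rightarrow> real^2"
  assumes "\<And>u. \<exists>X\<in>convex hull (A ` {1..n}). \<exists>Y\<in>convex hull (A ` {1..n}).
             (\<Sum>v\<leftarrow>vs. \<bar>v \<bullet> u\<bar>) \<le> 2 * (X \<bullet> u - Y \<bullet> u)"
  shows "(\<Sum>v\<leftarrow>vs. norm v) \<le> perimeter n A"
proof -
  let ?ws = "map (\<lambda>i. A i - A (i + 1)) [1..<n] @ [A n - A 1]"
  have expand: "(\<Sum>w\<leftarrow>?ws. F w) = (\<Sum>i\<in>{1..<n}. F (A i - A (i + 1))) + F (A n - A 1)"
    for F :: "real^2 \<Rightarrow> real"
    by (simp add: sum_list_distinct_conv_sum_set o_def)
  have "(\<Sum>v\<leftarrow>vs. norm v) \<le> (\<Sum>w\<leftarrow>?ws. norm w)"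
  proof (rule sum_norm_le_if_projections_le)
    fix u
    from assms obtain X Y where XY: "X \<in> convex hull (A ` {1..n})" "Y \<in> convex hull (A ` {1..n})"
      "(\<Sum>v\<leftarrow>vs. \<bar>v \<bullet> u\<bar>) \<le> 2 * (X \<bullet> u - Y \<bullet> u)" by blast
    obtain i where i: "i \<in> {1..n}" "X \<bullet> u \<le> A i \<bullet> u"
      using convex_hull_inner_le_vertex[OF _ XY(1), of u] by auto
    obtain j where j: "j \<in> {1..n}" "A j \<bullet> u \<le> Y \<bullet> u"
      using convex_hull_inner_le_vertex[OF _ XY(2), of "-u"] by auto
    note XY(3)
    also have "2 * (X \<bullet> u - Y \<bullet> u) \<le> 2 * \<bar>A i \<bullet> u - A j \<bullet> u\<bar>"
      using i(2) j(2) by (smt (verit))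
    also have "\<dots> \<le> (\<Sum>w\<leftarrow>?ws. \<bar>w \<bullet> u\<bar>)"
      unfolding expand inner_diff_left by (rule closed_walk_variation[OF i(1) j(1)])
    finally show "(\<Sum>v\<leftarrow>vs. \<bar>v \<bullet> u\<bar>) \<le> (\<Sum>w\<leftarrow>?ws. \<bar>w \<bullet> u\<bar>)" .
  qed
  then show ?thesis
    unfolding expand perimeter_def dist_norm .
qed

lemma perimeter_ge_triangle:
  fixes A :: "nat \<Rightarrow> real^2"
  assumes "X \<in> convex hull (A ` {1..n})" "Y \<in> convex hull (A ` {1..n})" "Z \<in> convex hull (A ` {1..n})"
  shows "dist X Y + dist Y Z + dist Z X \<le> perimeter n A"
proof -
  have "(\<Sum>v\<leftarrow>[X - Y, Y - Z, Z - X]. norm v) \<le> perimeter n A"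
  proof (rule perimeter_ge_if_projections_le_width)
    fix u
    have "\<exists>V\<in>{X,Y,Z}. \<exists>W\<in>{X,Y,Z}. (\<Sum>v\<leftarrow>[X - Y, Y - Z, Z - X]. \<bar>v \<bullet> u\<bar>) \<le> 2 * (V \<bullet> u - W \<bullet> u)"
      by (simp add: inner_diff_left) linarith
    moreover have "{X,Y,Z} \<subseteq> convex hull (A ` {1..n})"
      using assms by simp
    ultimately show "\<exists>V\<in>convex hull (A ` {1..n}). \<exists>W\<in>convex hull (A ` {1..n}).
        (\<Sum>v\<leftarrow>[X - Y, Y - Z, Z - X]. \<bar>v \<bullet> u\<bar>) \<le> 2 * (V \<bullet> u - W \<bullet> u)"
      by (meson subsetD)
  qed
  then show ?thesis by (simp add: dist_norm)
qed

section \<open>Pentagons with a common apex\<close>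

text \<open>
  Seen from the origin, \<open>m\<close> lies in the cone spanned by \<open>p\<close> and \<open>q\<close>, on or beyond the segment from
  \<open>p\<close> to \<open>q\<close>: this is what makes the quadrilateral \<open>0, p, m, q\<close> convex. The notion is kept for
  general vector spaces because it passes to the images under a linear functional, where it is used
  for real numbers.
\<close>
definition bulges :: "'a::real_vector \<Rightarrow> 'a \<Rightarrow> 'a \<Rightarrow> bool" where
  "bulges p m q \<longleftrightarrow> (\<exists>s\<ge>0. \<exists>t\<ge>0. 1 \<le> s + t \<and> m = s *\<^sub>R p + t *\<^sub>R q)"

lemma bulges_inner: "bulges p m q \<Longrightarrow> bulges (p \<bullet> u) (m \<bullet> u) (q \<bullet> u)"
  unfolding bulges_def by (metis inner_add_left inner_scaleR_left real_scaleR_def)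

lemma bulges_commute: "bulges p m q \<longleftrightarrow> bulges q m p"
  unfolding bulges_def by (metis add.commute)

text \<open>
  A point of the unit circle cannot lie strictly inside a triangle with one corner at the centre and
  the other two in the unit disc.
\<close>
lemma bulgesI:
  fixes p m q :: "'a::real_normed_vector"
  assumes "m = s *\<^sub>R p + t *\<^sub>R q" "0 \<le> s" "0 \<le> t" "norm m = 1" "norm p \<le> 1" "norm q \<le> 1"
  shows "bulges p m q"
proof -
  have "1 \<le> norm (s *\<^sub>R p) + norm (t *\<^sub>R q)"
    using assms(1,4) norm_triangle_ineq by metis
  also have "\<dots> \<le> s + t"
    using assms by (simp add: add_mono mult_left_le)
  finally show ?thesis
    unfolding bulges_def using assms by blast
qed

lemma bulges_uminus: "bulges p m q \<Longrightarrow> bulges (- p) (- m) (- q)"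
  unfolding bulges_def by (metis minus_add_distrib scaleR_minus_right)

text \<open>
  Between two nonnegative values a bulging value cannot dip below both of them. Passing to positive
  parts makes this hold whatever the signs are.
\<close>
lemma bulges_positive_part:
  fixes a m b :: real
  assumes "bulges a m b"
  shows "min (max a 0) (max b 0) \<le> max m 0"
proof (cases "0 \<le> a \<and> 0 \<le> b")
  case True
  obtain s t where st: "s \<ge> 0" "t \<ge> 0" "1 \<le> s + t" "m = s * a + t * b"
    using assms by (auto simp: bulges_def)
  have "1 * min a b \<le> (s + t) * min a b"
    using True st by (intro mult_right_mono) auto
  also have "\<dots> \<le> s * a + t * b"
    using st by (auto simp: distrib_right intro!: add_mono mult_left_mono)
  finally show ?thesis using True st by simp
qed auto

text \<open>
  A sequence from \<open>0\<close> back to \<open>0\<close> without valleys rises to its maximum and then falls, so it covers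
  every height up to the maximum twice.
\<close>
lemma variation_without_valleys:
  fixes a x y b :: real
  assumes "min a y \<le> x" "min a b \<le> x" "min a b \<le> y" "min x b \<le> y"
    and "0 \<le> a" "0 \<le> b" "a \<le> h" "x \<le> h" "y \<le> h" "b \<le> h"
  shows "a + \<bar>a - x\<bar> + \<bar>x - y\<bar> + \<bar>y - b\<bar> + b \<le> 2 * h"
proof -
  \<comment> \<open>The three cases are the possible positions of the peak: \<open>y\<close> or \<open>b\<close>, then \<open>x\<close>, then \<open>a\<close>.\<close>
  have "a \<le> x \<and> x \<le> y \<or> a \<le> x \<and> b \<le> y \<and> y \<le> x \<or> x \<le> a \<and> y \<le> x \<and> b \<le> y"
    using assms(1-4) by (auto simp: min_def split: if_splits)
  then show ?thesis
    using assms by (elim disjE) (auto simp: min_def abs_if split: if_splits)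
qed

text \<open>
  This is the statement that a convex pentagon projects onto a line covering its width twice. All
  four triples in the order \<open>a, x, y, b\<close> are required to bulge, since conditions on neighbours
  alone would not exclude a flat valley \<open>x = y\<close> below both \<open>a\<close> and \<open>b\<close>.
\<close>
lemma bulging_cycle_variation:
  fixes a x y b :: real
  assumes bulges: "bulges a x y" "bulges a x b" "bulges a y b" "bulges x y b"
  shows "\<exists>h\<in>{0,a,x,y,b}. \<exists>l\<in>{0,a,x,y,b}. \<bar>a\<bar> + \<bar>a - x\<bar> + \<bar>x - y\<bar> + \<bar>y - b\<bar> + \<bar>b\<bar> \<le> 2 * (h - l)"
proof -
  define h l where "h = Max {0,a,x,y,b}" and "l = Min {0,a,x,y,b}"
  have mem: "h \<in> {0,a,x,y,b}" "l \<in> {0,a,x,y,b}"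
    unfolding h_def l_def by (rule Max_in Min_in; simp)+
  have h: "0 \<le> h" "a \<le> h" "x \<le> h" "y \<le> h" "b \<le> h"
    unfolding h_def by (rule Max_ge; simp)+
  have l: "l \<le> 0" "l \<le> a" "l \<le> x" "l \<le> y" "l \<le> b"
    unfolding l_def by (rule Min_le; simp)+
  \<comment> \<open>The positive and the negative part of the sequence are free of valleys, and the variation is
    the sum of theirs.\<close>
  have split: "\<bar>r - s\<bar> = \<bar>max r 0 - max s 0\<bar> + \<bar>max (- r) 0 - max (- s) 0\<bar>" for r s :: real
    by (auto simp: max_def)
  have split0: "\<bar>r\<bar> = max r 0 + max (- r) 0" for r :: real
    by (auto simp: max_def)
  have "\<bar>a\<bar> + \<bar>a - x\<bar> + \<bar>x - y\<bar> + \<bar>y - b\<bar> + \<bar>b\<bar> =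
      (max a 0 + \<bar>max a 0 - max x 0\<bar> + \<bar>max x 0 - max y 0\<bar> + \<bar>max y 0 - max b 0\<bar> + max b 0) +
      (max (- a) 0 + \<bar>max (- a) 0 - max (- x) 0\<bar> + \<bar>max (- x) 0 - max (- y) 0\<bar>
        + \<bar>max (- y) 0 - max (- b) 0\<bar> + max (- b) 0)"
    unfolding split[of a x] split[of x y] split[of y b] split0[of a] split0[of b] by (simp only: ac_simps)
  also have "\<dots> \<le> 2 * h + 2 * (- l)"
    using h l by (intro add_mono variation_without_valleys bulges_positive_part bulges_uminus bulges) auto
  finally have "\<bar>a\<bar> + \<bar>a - x\<bar> + \<bar>x - y\<bar> + \<bar>y - b\<bar> + \<bar>b\<bar> \<le> 2 * (h - l)"
    by (simp only: right_diff_distrib mult_minus_right add_uminus_conv_diff)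
  then show ?thesis using mem by blast
qed

lemma perimeter_ge_pentagon:
  fixes A :: "nat \<Rightarrow> real^2"
  assumes "B \<in> convex hull (A ` {1..n})" "V \<in> convex hull (A ` {1..n})" "X \<in> convex hull (A ` {1..n})"
    "Y \<in> convex hull (A ` {1..n})" "W \<in> convex hull (A ` {1..n})"
    and "bulges (V - B) (X - B) (Y - B)" "bulges (V - B) (X - B) (W - B)"
    "bulges (V - B) (Y - B) (W - B)" "bulges (X - B) (Y - B) (W - B)"
  shows "dist V B + dist V X + dist X Y + dist Y W + dist W B \<le> perimeter n A"
proof -
  let ?vs = "[V - B, V - X, X - Y, Y - W, W - B]"
  have "(\<Sum>v\<leftarrow>?vs. norm v) \<le> perimeter n A"
  proof (rule perimeter_ge_if_projections_le_width)
    fix u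
    let ?S = "{0, (V - B) \<bullet> u, (X - B) \<bullet> u, (Y - B) \<bullet> u, (W - B) \<bullet> u}"
    obtain h l where h: "h \<in> ?S" and l: "l \<in> ?S"
      and le: "\<bar>(V - B) \<bullet> u\<bar> + \<bar>(V - B) \<bullet> u - (X - B) \<bullet> u\<bar> + \<bar>(X - B) \<bullet> u - (Y - B) \<bullet> u\<bar>
        + \<bar>(Y - B) \<bullet> u - (W - B) \<bullet> u\<bar> + \<bar>(W - B) \<bullet> u\<bar> \<le> 2 * (h - l)"
      using bulging_cycle_variation[OF assms(6-9)[THEN bulges_inner, of u]] by blast
    have in_P: "\<exists>Z\<in>convex hull (A ` {1..n}). k = Z \<bullet> u - B \<bullet> u" if "k \<in> ?S" for k
      using that assms(1-5) by (auto simp: inner_diff_left)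
    obtain H L where "H \<in> convex hull (A ` {1..n})" "h = H \<bullet> u - B \<bullet> u"
      "L \<in> convex hull (A ` {1..n})" "l = L \<bullet> u - B \<bullet> u"
      using in_P[OF h] in_P[OF l] by blast
    moreover have "(\<Sum>v\<leftarrow>?vs. \<bar>v \<bullet> u\<bar>) \<le> 2 * (h - l)"
      using le by (simp add: inner_diff_left)
    ultimately show "\<exists>H\<in>convex hull (A ` {1..n}). \<exists>L\<in>convex hull (A ` {1..n}).
        (\<Sum>v\<leftarrow>?vs. \<bar>v \<bullet> u\<bar>) \<le> 2 * (H \<bullet> u - L \<bullet> u)"
      by force
  qed
  then show ?thesis by (simp add: dist_norm)
qed

text \<open>
  The hypothesis \<open>t * s' \<le> s * t'\<close> compares slopes: it says that \<open>x\<close> comes before \<open>y\<close> when the cone is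
  swept from \<open>p\<close> to \<open>q\<close>. Then \<open>x\<close> lies in the cone of \<open>p\<close> and \<open>y\<close>.
\<close>
lemma bulging_order:
  fixes p q x y :: "'a::real_normed_vector"
  assumes x: "x = s *\<^sub>R p + t *\<^sub>R q" "0 \<le> s" "0 \<le> t" "norm x = 1"
    and y: "y = s' *\<^sub>R p + t' *\<^sub>R q" "0 \<le> s'" "0 \<le> t'" "norm y = 1"
    and order: "t * s' \<le> s * t'" and pq: "norm p \<le> 1" "norm q \<le> 1"
  shows "bulges p x y"
proof (cases "t' = 0")
  case False
  show ?thesis
  proof (rule bulgesI)
    show "x = ((s * t' - t * s') / t') *\<^sub>R p + (t / t') *\<^sub>R y"
      using False by (simp add: x(1) y(1) algebra_simps diff_divide_distrib)
  qed (use assms in auto)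
next
  \<comment> \<open>Here \<open>y\<close> lies on the ray through \<open>p\<close>, and the order forces \<open>x\<close> onto the same ray; both being
    unit vectors, they coincide.\<close>
  case True
  then have "s' \<noteq> 0"
    using y by auto
  with True order x(3) y(2) have "t = 0"
    by (simp add: mult_le_0_iff)
  with True x y have "s * norm p = 1" "s' * norm p = 1"
    by auto
  then have "s = s'"
    by (metis mult_cancel_right mult_zero_right zero_neq_one)
  show ?thesis
  proof (rule bulgesI)
    show "x = 0 *\<^sub>R p + 1 *\<^sub>R y"
      using True \<open>t = 0\<close> \<open>s = s'\<close> by (simp add: x(1) y(1))
  qed (use assms in auto)
qed

lemma perimeter_ge_fan:
  fixes A :: "nat \<Rightarrow> real^2"
  assumes P: "B \<in> convex hull (A ` {1..n})" "V \<in> convex hull (A ` {1..n})" "X \<in> convex hull (A ` {1..n})"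
    "Y \<in> convex hull (A ` {1..n})" "W \<in> convex hull (A ` {1..n})"
    and X: "X - B = s *\<^sub>R (V - B) + t *\<^sub>R (W - B)" "0 \<le> s" "0 \<le> t" "dist X B = 1"
    and Y: "Y - B = s' *\<^sub>R (V - B) + t' *\<^sub>R (W - B)" "0 \<le> s'" "0 \<le> t'" "dist Y B = 1"
    and order: "t * s' \<le> s * t'" and "dist V B \<le> 1" "dist W B \<le> 1"
  shows "dist V B + dist V X + dist X Y + dist Y W + dist W B \<le> perimeter n A"
proof -
  have norms: "norm (X - B) = 1" "norm (Y - B) = 1" "norm (V - B) \<le> 1" "norm (W - B) \<le> 1"
    using assms by (auto simp: dist_norm)
  have "bulges (V - B) (X - B) (W - B)" "bulges (V - B) (Y - B) (W - B)"
    using X Y norms bulgesI by blast+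
  moreover have "bulges (V - B) (X - B) (Y - B)"
    using bulging_order[OF X(1-3) norms(1) Y(1-3) norms(2) order norms(3,4)] .
  moreover have "bulges (W - B) (Y - B) (X - B)"
  proof (rule bulging_order)
    show "Y - B = t' *\<^sub>R (W - B) + s' *\<^sub>R (V - B)" "X - B = t *\<^sub>R (W - B) + s *\<^sub>R (V - B)"
      by (simp_all only: X(1) Y(1) add.commute)
    show "s' * t \<le> t' * s" using order by (simp add: mult.commute)
  qed (use X Y norms in auto)
  ultimately show ?thesis
    using P by (intro perimeter_ge_pentagon) (auto simp: bulges_commute)
qed

section \<open>A convex polygon lies in the angle at each vertex\<close>

text \<open>
  Faces of a polytope are exposed, so the line through an edge supports the polytope. A further
  vertex \<open>W\<close> is strictly on the inner side because no point of the edge other than its ends is extreme.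
\<close>
lemma edge_supporting_line:
  fixes P :: "(real^2) set"
  assumes "polytope P" "closed_segment U B edge_of P" "W extreme_point_of P" "W \<noteq> U" "W \<noteq> B"
  obtains a where "a \<bullet> (U - B) = 0" "a \<bullet> (W - B) < 0" "\<And>X. X \<in> P \<Longrightarrow> a \<bullet> (X - B) \<le> 0"
proof -
  have face: "closed_segment U B face_of P"
    using assms by (simp add: edge_of_def)
  then obtain a b where sub: "P \<subseteq> {x. a \<bullet> x \<le> b}" and eq: "closed_segment U B = P \<inter> {x. a \<bullet> x = b}"
    using assms(1) exposed_face_of_polyhedron[OF polytope_imp_polyhedron]
    unfolding exposed_face_of_def by metis
  have UB: "a \<bullet> U = b" "a \<bullet> B = b" "U \<in> P" "B \<in> P"
    using eq ends_in_segment by auto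
  have "W \<notin> closed_segment U B"
    using assms UB by (auto simp: extreme_point_of_def open_segment_def)
  then have "a \<bullet> W \<noteq> b" and "W \<in> P"
    using assms(3) eq by (auto simp: extreme_point_of_def)
  with sub have "a \<bullet> W < b" by auto
  with UB sub show thesis
    by (intro that[of a]) (auto simp: inner_diff_right)
qed

text \<open>
  The normals \<open>a\<close> and \<open>c\<close> form, up to negative factors, the basis dual to \<open>q, p\<close>; their signs at \<open>x\<close> are
  therefore opposite to those of the coordinates of \<open>x\<close> in the basis \<open>p, q\<close>.
\<close>
lemma cone_of_two_supporting_lines:
  fixes a c p q x :: "real^2"
  assumes "a \<bullet> p = 0" "a \<bullet> q < 0" "c \<bullet> q = 0" "c \<bullet> p < 0" "a \<bullet> x \<le> 0" "c \<bullet> x \<le> 0"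
  obtains s t where "0 \<le> s" "0 \<le> t" "x = s *\<^sub>R p + t *\<^sub>R q"
proof -
  define s t where "s = (c \<bullet> x) / (c \<bullet> p)" and "t = (a \<bullet> x) / (a \<bullet> q)"
  define w where "w = x - (s *\<^sub>R p + t *\<^sub>R q)"
  define D where "D = a $ 1 * c $ 2 - a $ 2 * c $ 1"
  have inner: "u \<bullet> v = u $ 1 * v $ 1 + u $ 2 * v $ 2" for u v :: "real^2"
    by (simp add: inner_vec_def sum_2)
  \<comment> \<open>\<open>D\<close> is the determinant of \<open>a, c\<close>; it does not vanish, so \<open>w\<close>, orthogonal to both, is zero.\<close>
  have "D * p $ 2 = a $ 1 * (c \<bullet> p)" "D * p $ 1 = - a $ 2 * (c \<bullet> p)"
    using assms(1) unfolding D_def inner by algebra+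
  moreover have "a \<noteq> 0"
    using assms by auto
  ultimately have "D \<noteq> 0"
    using assms(4) by (auto simp: vec_eq_iff forall_2)
  have aw: "a \<bullet> w = 0" and cw: "c \<bullet> w = 0"
    using assms by (auto simp: w_def s_def t_def inner_diff_right inner_add_right)
  have "D * w $ 1 = 0" "D * w $ 2 = 0"
    using aw cw unfolding D_def inner by algebra+
  then have "w = 0"
    using \<open>D \<noteq> 0\<close> by (simp add: vec_eq_iff forall_2)
  show thesis
  proof (rule that)
    show "0 \<le> s" "0 \<le> t"
      using assms by (simp_all add: s_def t_def divide_nonpos_neg)
    show "x = s *\<^sub>R p + t *\<^sub>R q"
      using \<open>w = 0\<close> by (simp only: w_def right_minus_eq)
  qed
qed

section \<open>The inequality\<close>

text \<open>
  Ptolemy's inequality for the four points \<open>0, p, d, e\<close> when \<open>d\<close> and \<open>e\<close> are unit vectors. For a unit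
  vector \<open>x\<close> the segment from \<open>p\<close> to \<open>x\<close> is as long as that from \<open>sgn p\<close> to \<open>norm p *\<^sub>R x\<close>, by
  reflection in the bisector of the angle between them. Applied to \<open>d\<close> and \<open>e\<close> with \<open>sgn p\<close> as the common
  end, the claim becomes the ordinary triangle inequality.
\<close>
lemma ptolemy_unit:
  fixes p d e :: "'a::real_inner"
  assumes "norm d = 1" "norm e = 1"
  shows "norm (p - d) \<le> norm (p - e) + norm p * norm (d - e)"
proof (cases "p = 0")
  case False
  have swap: "norm (p - x) = norm (norm p *\<^sub>R x - sgn p)" if "norm x = 1" for x
  proof -
    have "p \<bullet> x = norm p * (x \<bullet> sgn p)" "sgn p \<bullet> sgn p = 1"
      using False by (auto simp: sgn_div_norm inner_commute dot_square_norm norm_sgn)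
    moreover have "x \<bullet> x = 1" "p \<bullet> p = norm p * norm p"
      using that by (auto simp: dot_square_norm power2_eq_square)
    ultimately show ?thesis
      by (simp add: norm_eq inner_diff inner_commute)
  qed
  have "norm p *\<^sub>R d - sgn p = (norm p *\<^sub>R e - sgn p) + norm p *\<^sub>R (d - e)"
    by (simp add: algebra_simps)
  then have "norm (norm p *\<^sub>R d - sgn p) \<le> norm (norm p *\<^sub>R e - sgn p) + norm (norm p *\<^sub>R (d - e))"
    by (metis norm_triangle_ineq)
  then show ?thesis
    using assms by (simp add: swap)
qed (use assms in simp)

lemma crossed_struts:
  fixes B V W D E :: "'a::real_inner"
  assumes "dist V D = 1" "dist D B = 1" "dist W E = 1" "dist E B = 1"
    and "1 \<le> dist V B + dist W B" "dist D E \<le> 1"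
  shows "3 \<le> dist V B + dist V E + dist E D + dist D W + dist W B"
proof -
  have "1 \<le> dist V E + dist V B * dist D E" "1 \<le> dist W D + dist W B * dist D E"
    using ptolemy_unit[of "D - B" "E - B" "V - B"] ptolemy_unit[of "E - B" "D - B" "W - B"] assms
    by (auto simp: dist_norm norm_minus_commute)
  \<comment> \<open>Adding the two bounds leaves exactly this product above \<open>3\<close>.\<close>
  moreover have "0 \<le> (dist V B + dist W B - 1) * (1 - dist D E)"
    using assms by simp
  ultimately show ?thesis
    by (simp add: dist_commute algebra_simps)
qed

theorem theorem2:
  fixes P :: "(real^2) set" and n :: nat and A :: "nat \<Rightarrow> real^2"
  assumes "n \<ge> 3"
    and "convex_polygon P n A"
    and "has_strut P (A 1) (A 2)"
    and "has_strut P (A 2) (A 3)"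
    and "dist (A 1) (A 2) + dist (A 2) (A 3) \<ge> 1"
  shows "perimeter n A \<ge> 3"
proof -
  have P: "P = convex hull (A ` {1..n})" and inj: "inj_on A {1..n}"
    and ext: "{X. X extreme_point_of P} = A ` {1..n}"
    and sides: "\<forall>i\<in>{1..<n}. closed_segment (A i) (A (i + 1)) edge_of P"
    using assms(2) by (auto simp: convex_polygon_def is_side_def)
  have idx: "1 \<in> {1..n}" "2 \<in> {1..n}" "3 \<in> {1..n}"
    using assms(1) by auto
  have ex: "A i extreme_point_of P" and mem: "A i \<in> P" if "i \<in> {1..n}" for i
  proof -
    show "A i extreme_point_of P" using ext that by blast
    then show "A i \<in> P" by (simp add: extreme_point_of_def)
  qed
  have distinct: "A 1 \<noteq> A 2" "A 3 \<noteq> A 2" "A 1 \<noteq> A 3"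
    using inj_on_eq_iff[OF inj] idx by auto
  have edges: "closed_segment (A 1) (A 2) edge_of P" "closed_segment (A 3) (A 2) edge_of P"
    using bspec[OF sides, of 1] bspec[OF sides, of 2] assms(1)
    by (auto simp: numeral_2_eq_2 numeral_3_eq_3 closed_segment_commute)
  have poly: "polytope P"
    by (simp add: P polytope_convex_hull)
  obtain a where a: "a \<bullet> (A 1 - A 2) = 0" "a \<bullet> (A 3 - A 2) < 0" "\<And>X. X \<in> P \<Longrightarrow> a \<bullet> (X - A 2) \<le> 0"
    using edge_supporting_line[OF poly edges(1) ex[OF idx(3)]] distinct by metis
  obtain c where c: "c \<bullet> (A 3 - A 2) = 0" "c \<bullet> (A 1 - A 2) < 0" "\<And>X. X \<in> P \<Longrightarrow> c \<bullet> (X - A 2) \<le> 0"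
    using edge_supporting_line[OF poly edges(2) ex[OF idx(1)]] distinct by metis
  obtain D where D: "D \<in> P" "dist (A 1) D = 1" "dist D (A 2) = 1"
    using assms(3) by (auto simp: has_strut_def dist_commute)
  obtain E where E: "E \<in> P" "dist (A 3) E = 1" "dist E (A 2) = 1"
    using assms(4) by (auto simp: has_strut_def dist_commute)
  note in_P = mem[OF idx(1)] mem[OF idx(2)] mem[OF idx(3)] D(1) E(1)
  have triangle: "dist X Y + dist Y Z + dist Z X \<le> perimeter n A" if "X \<in> P" "Y \<in> P" "Z \<in> P" for X Y Z
    using perimeter_ge_triangle that unfolding P .
  consider "1 \<le> dist (A 1) (A 2)" | "1 \<le> dist (A 3) (A 2)" | "1 \<le> dist D E"
    | (small) "dist (A 1) (A 2) \<le> 1" "dist (A 3) (A 2) \<le> 1" "dist D E \<le> 1"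
    by linarith
  then show ?thesis
  proof cases
    case 1
    then show ?thesis
      using triangle[of "A 1" "A 2" D] in_P D by (simp add: dist_commute)
  next
    case 2
    then show ?thesis
      using triangle[of "A 3" "A 2" E] in_P E by (simp add: dist_commute)
  next
    case 3
    then show ?thesis
      using triangle[of "A 2" D E] in_P D E by (simp add: dist_commute)
  next
    case small
    obtain s t where d: "0 \<le> s" "0 \<le> t" "D - A 2 = s *\<^sub>R (A 1 - A 2) + t *\<^sub>R (A 3 - A 2)"
      using cone_of_two_supporting_lines[OF a(1,2) c(1,2) a(3)[OF D(1)] c(3)[OF D(1)]] .
    obtain s' t' where e: "0 \<le> s'" "0 \<le> t'" "E - A 2 = s' *\<^sub>R (A 1 - A 2) + t' *\<^sub>R (A 3 - A 2)"
      using cone_of_two_supporting_lines[OF a(1,2) c(1,2) a(3)[OF E(1)] c(3)[OF E(1)]] .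
    show ?thesis
    \<comment> \<open>The cases are the two orders in which \<open>D\<close> and \<open>E\<close> appear around \<open>A 2\<close>.\<close>
    proof (cases "t * s' \<le> s * t'")
      case True
      have "dist (A 1) (A 2) + dist (A 1) D + dist D E + dist E (A 3) + dist (A 3) (A 2) \<le> perimeter n A"
        using perimeter_ge_fan[OF in_P(2,1,4,5,3)[unfolded P] d(3,1,2) D(3) e(3,1,2) E(3) True] small
        by blast
      then show ?thesis
        using D(2) E(2) assms(5) zero_le_dist[of D E] dist_commute[of E "A 3"] dist_commute[of "A 3" "A 2"]
        by linarith
    next
      case False
      then have "t' * s \<le> s' * t" by (simp add: mult.commute)
      then have "dist (A 1) (A 2) + dist (A 1) E + dist E D + dist D (A 3) + dist (A 3) (A 2) \<le> perimeter n A"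
        using perimeter_ge_fan[OF in_P(2,1,5,4,3)[unfolded P] e(3,1,2) E(3) d(3,1,2) D(3)] small
        by blast
      then show ?thesis
        using crossed_struts[of "A 1" D "A 2" "A 3" E] D E small assms(5) by (simp add: dist_commute)
    qed
  qed
qed

end
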